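(* Let $P$ be a $k$-vertex unit disk graph with a given embedding of ply $p$, and let $s$ be an integer. Then (a) $\sigma_s(P)\le 2^{O(s\log k + pk/\log k)}$, and (b) if $P$ is connected, then $\sigma_s(P)\le 2^{O(s\log k)}$.
   Context: A unit disk graph is a graph whose vertices can be represented by closed disks of equal (unit) size in the plane, two vertices being adjacent iff their disks intersect; such a representation is an embedding. An embedding has ply $p$ if every point of the plane is contained in at most $p$ of the disks. A separation of $P$ of order $s$ is a pair $(A,B)$ with $A\cup B=V(P)$, $|A\cap B|=s$, and no edges between $A\setminus B$ and $B\setminus A$. Separations $(A,B)$ and $(C,D)$ of $P$ are isomorphic if there is a bijection $f:V(P)\to V(P)$ with $uv\in E(P)\Leftrightarrow f(u)f(v)\in E(P)$ for all $u,v$, $f(A)=C$, $f(B)=D$, and $f(u)=u$ for all $u\in A\cap B$. $\sigma_s(P)$ denotes the size of a maximal set of pairwise non-isomorphic separations of $P$ of order at most $s$.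
   Formalization: The formal statement assumes k ≥ 2 (for k ≤ 1, log k is zero or undefined) and, in (b), s ≠ 0, since for connected P the separations (V,∅) and (∅,V) give σ_0(P) = 2 > 2^0. *)

theory Defs
  imports "HOL-Analysis.Analysis" "Graph_Theory.Graph_Theory"
begin

text \<open>
  Finite simple undirected graphs are symmetric, loop-free, finite digraphs without parallel
  arcs (locale \<^locale>\<open>pair_graph\<close>): an edge between u and v is the pair of arcs (u,v), (v,u).

  The map c sends a vertex to the centre of its disk, which has radius 1.  It need not be
  injective: distinct vertices may be represented by the same disk.
\<close>

definition unit_disk_embedding :: "'a pair_pre_digraph \<Rightarrow> ('a \<Rightarrow> real^2) \<Rightarrow> bool" where
  "unit_disk_embedding P c \<longleftrightarrow>
    (\<forall>u\<in>pverts P. \<forall>v\<in>pverts P. u \<noteq> v \<longrightarrow>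
      ((u, v) \<in> parcs P \<longleftrightarrow> cball (c u) 1 \<inter> cball (c v) 1 \<noteq> {}))"

text \<open>Coinciding disks of distinct vertices are counted separately.\<close>

definition embedding_ply :: "'a pair_pre_digraph \<Rightarrow> ('a \<Rightarrow> real^2) \<Rightarrow> nat \<Rightarrow> bool" where
  "embedding_ply P c p \<longleftrightarrow> (\<forall>x. card {v \<in> pverts P. x \<in> cball (c v) 1} \<le> p)"

definition separation :: "'a pair_pre_digraph \<Rightarrow> 'a set \<times> 'a set \<Rightarrow> bool" where
  "separation P = (\<lambda>(A, B). A \<union> B = pverts P \<and>
    (\<forall>u\<in>A - B. \<forall>v\<in>B - A. (u, v) \<notin> parcs P \<and> (v, u) \<notin> parcs P))"

definition sep_order :: "'a set \<times> 'a set \<Rightarrow> nat" where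
  "sep_order = (\<lambda>(A, B). card (A \<inter> B))"

definition sep_isomorphic ::
    "'a pair_pre_digraph \<Rightarrow> 'a set \<times> 'a set \<Rightarrow> 'a set \<times> 'a set \<Rightarrow> bool" where
  "sep_isomorphic P = (\<lambda>(A, B) (C, D). \<exists>f. bij_betw f (pverts P) (pverts P) \<and>
    (\<forall>u\<in>pverts P. \<forall>v\<in>pverts P. (u, v) \<in> parcs P \<longleftrightarrow> (f u, f v) \<in> parcs P) \<and>
    f ` A = C \<and> f ` B = D \<and> (\<forall>u\<in>A \<inter> B. f u = u))"

definition noniso_seps :: "'a pair_pre_digraph \<Rightarrow> int \<Rightarrow> ('a set \<times> 'a set) set set" where
  "noniso_seps P s = {M. (\<forall>X\<in>M. separation P X \<and> int (sep_order X) \<le> s) \<and>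
    pairwise (\<lambda>X Y. \<not> sep_isomorphic P X Y) M}"

text \<open>
  The maximum is over all sizes; by \<open>card_maximal_noniso_seps\<close> below, every
  inclusion-maximal set of pairwise non-isomorphic separations has this size.
\<close>

definition sigma_sep :: "'a pair_pre_digraph \<Rightarrow> int \<Rightarrow> nat" where
  "sigma_sep P s = Max (card ` noniso_seps P s)"

lemma sep_isomorphic_refl: "sep_isomorphic P X X"
  unfolding sep_isomorphic_def by (cases X) (auto intro!: exI[of _ id])

lemma sep_isomorphic_sym:
  assumes "separation P X" "sep_isomorphic P X Y"
  shows "sep_isomorphic P Y X"
proof -
  obtain A B C D where XY: "X = (A, B)" "Y = (C, D)" by (cases X, cases Y)
  let ?V = "pverts P"
  have AB: "A \<subseteq> ?V" "B \<subseteq> ?V" using assms(1) XY by (auto simp: separation_def)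
  obtain f where f: "bij_betw f ?V ?V"
      "\<And>u v. u \<in> ?V \<Longrightarrow> v \<in> ?V \<Longrightarrow> (u, v) \<in> parcs P \<longleftrightarrow> (f u, f v) \<in> parcs P"
      "f ` A = C" "f ` B = D" "\<And>u. u \<in> A \<inter> B \<Longrightarrow> f u = u"
    using assms(2) XY by (auto simp: sep_isomorphic_def)
  define g where "g = inv_into ?V f"
  have inj: "inj_on f ?V" and im: "f ` ?V = ?V" using f(1) by (auto simp: bij_betw_def)
  have g: "bij_betw g ?V ?V" unfolding g_def by (rule bij_betw_inv_into[OF f(1)])
  have fg: "f (g u) = u" if "u \<in> ?V" for u
    using that im by (simp add: g_def f_inv_into_f)
  have gV: "g u \<in> ?V" if "u \<in> ?V" for u using g that by (auto simp: bij_betw_def)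
  have gC: "g ` C = A" "g ` D = B"
    using inv_into_image_cancel[OF inj AB(1)] inv_into_image_cancel[OF inj AB(2)] f(3,4)
    by (auto simp: g_def)
  have CD: "C \<inter> D = A \<inter> B"
  proof -
    have "C \<inter> D = f ` (A \<inter> B)" using inj_on_image_Int[OF inj AB] f(3,4) by simp
    also have "\<dots> = A \<inter> B" using f(5) by (auto simp: image_iff)
    finally show ?thesis .
  qed
  have fixg: "g u = u" if "u \<in> C \<inter> D" for u
    using that CD f(5)[of u] inj AB by (metis IntD1 g_def inv_into_f_f subsetD)
  have edges: "(u, v) \<in> parcs P \<longleftrightarrow> (g u, g v) \<in> parcs P" if "u \<in> ?V" "v \<in> ?V" for u v
    using f(2)[OF gV gV, OF that] fg that by simp
  show ?thesis
    unfolding XY sep_isomorphic_def using g gC fixg edges by auto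
qed

lemma sep_isomorphic_trans:
  assumes "separation P X" "separation P Y" "sep_isomorphic P X Y" "sep_isomorphic P Y Z"
  shows "sep_isomorphic P X Z"
proof -
  obtain A B C D E F where XYZ: "X = (A, B)" "Y = (C, D)" "Z = (E, F)"
    by (cases X, cases Y, cases Z)
  let ?V = "pverts P"
  obtain f where f: "bij_betw f ?V ?V"
      "\<And>u v. u \<in> ?V \<Longrightarrow> v \<in> ?V \<Longrightarrow> (u, v) \<in> parcs P \<longleftrightarrow> (f u, f v) \<in> parcs P"
      "f ` A = C" "f ` B = D" "\<And>u. u \<in> A \<inter> B \<Longrightarrow> f u = u"
    using assms(3) XYZ by (auto simp: sep_isomorphic_def)
  obtain g where g: "bij_betw g ?V ?V"
      "\<And>u v. u \<in> ?V \<Longrightarrow> v \<in> ?V \<Longrightarrow> (u, v) \<in> parcs P \<longleftrightarrow> (g u, g v) \<in> parcs P"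
      "g ` C = E" "g ` D = F" "\<And>u. u \<in> C \<inter> D \<Longrightarrow> g u = u"
    using assms(4) XYZ by (auto simp: sep_isomorphic_def)
  have fV: "f u \<in> ?V" if "u \<in> ?V" for u using f(1) that by (auto simp: bij_betw_def)
  have "(u, v) \<in> parcs P \<longleftrightarrow> ((g \<circ> f) u, (g \<circ> f) v) \<in> parcs P" if "u \<in> ?V" "v \<in> ?V" for u v
    using f(2)[OF that] g(2)[OF fV fV, OF that] by simp
  moreover have "(g \<circ> f) u = u" if "u \<in> A \<inter> B" for u
  proof -
    have "f u \<in> C \<inter> D" using that f(3,4) by blast
    with f(5)[OF that] g(5)[of u] show ?thesis by simp
  qed
  moreover have "(g \<circ> f) ` A = E" "(g \<circ> f) ` B = F"
    unfolding image_comp[symmetric] f(3,4) g(3,4) by (rule refl)+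
  ultimately show ?thesis
    unfolding XYZ sep_isomorphic_def using bij_betw_trans[OF f(1) g(1)] by auto
qed

lemma finite_noniso_seps:
  assumes "finite (pverts P)"
  shows "finite (noniso_seps P s)" "M \<in> noniso_seps P s \<Longrightarrow> finite M"
proof -
  have fin: "finite (Pow (pverts P) \<times> Pow (pverts P))" using assms by simp
  have sub: "N \<subseteq> Pow (pverts P) \<times> Pow (pverts P)" if "N \<in> noniso_seps P s" for N
    using that by (auto simp: noniso_seps_def separation_def)
  show "finite (noniso_seps P s)"
    by (rule finite_subset[of _ "Pow (Pow (pverts P) \<times> Pow (pverts P))"]) (use sub fin in auto)
  show "M \<in> noniso_seps P s \<Longrightarrow> finite M" using sub fin by (blast intro: finite_subset)
qed

lemma card_maximal_noniso_seps:
  assumes fin: "finite (pverts P)" and M: "M \<in> noniso_seps P s"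
    and max: "\<And>N. N \<in> noniso_seps P s \<Longrightarrow> M \<subseteq> N \<Longrightarrow> N = M"
  shows "card M = sigma_sep P s"
proof -
  have sepM: "separation P X" if "X \<in> M" for X using M that by (auto simp: noniso_seps_def)
  have le: "card N \<le> card M" if N: "N \<in> noniso_seps P s" for N
  proof -
    have sepN: "separation P X" if "X \<in> N" for X using N that by (auto simp: noniso_seps_def)
    have "\<exists>Y\<in>M. sep_isomorphic P X Y" if X: "X \<in> N" for X
    proof (rule ccontr)
      assume neg: "\<not> ?thesis"
      then have "\<not> sep_isomorphic P Y X" if "Y \<in> M" for Y
        using sep_isomorphic_sym[OF sepM[OF that]] that by blast
      with neg have "insert X M \<in> noniso_seps P s"
        using M N X by (auto simp: noniso_seps_def pairwise_insert)
      from max[OF this] have "X \<in> M" by auto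
      with neg sep_isomorphic_refl show False by blast
    qed
    then obtain h where h: "\<And>X. X \<in> N \<Longrightarrow> h X \<in> M \<and> sep_isomorphic P X (h X)" by metis
    have "inj_on h N"
    proof (rule inj_onI, rule ccontr)
      fix X Y assume XY: "X \<in> N" "Y \<in> N" "h X = h Y" "X \<noteq> Y"
      have "sep_isomorphic P (h X) Y"
        using sep_isomorphic_sym[OF sepN[OF XY(2)]] h[OF XY(2)] XY(3) by metis
      then have "sep_isomorphic P X Y"
        using sep_isomorphic_trans[OF sepN[OF XY(1)] sepM] h[OF XY(1)] by blast
      with XY N show False by (auto simp: noniso_seps_def pairwise_def)
    qed
    then show ?thesis
      by (rule card_inj_on_le) (use h finite_noniso_seps(2)[OF fin M] in auto)
  qed
  show ?thesis
    unfolding sigma_sep_def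
    by (rule Max_eqI[symmetric]) (use finite_noniso_seps(1)[OF fin] le M in auto)
qed

end

theory Submission
  imports Defs
begin

text \<open>
  Round the disk centres to the integer grid.  Vertices in a common cell are adjacent, there are at
  most p of them, and neighbours lie in cells at distance at most 2.  For a separation \<open>(A, B)\<close> with
  \<open>S = A \<inter> B\<close>, the at most 25 |S| cells near S record the sides of all vertices
  adjacent to S, and this determines \<open>(A, B)\<close> on every component of P that meets S.  If P is connected,
  nothing else is left.  Otherwise the side of each component with more than \<open>m \<approx> log k / (50 p)\<close>
  vertices is recorded individually, which costs \<open>O(p k / log k)\<close> bits.  For the smaller components
  only the number of those on side \<open>A\<close> is recorded per isomorphism type; exploring a component vertex
  by vertex encodes its type by 25 p bits per vertex, so there are at most \<open>2\<^sup>2\<^sup>5\<^sup>p\<^sup>m \<le> sqrt k\<close> types.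
\<close>

section \<open>Finite combinatorics\<close>

text \<open>A set of at most \<open>n + 1\<close> elements either has at most \<open>n\<close> or
  arises from such a set by inserting one element. With \<open>None\<close> for the first case, each
  unit of size costs a factor \<open>card V + 1\<close>.\<close>

lemma card_subsets_card_le:
  assumes "finite V"
  shows "card {S. S \<subseteq> V \<and> card S \<le> n} \<le> (card V + 1) ^ n"
proof (induction n)
  case 0
  have "{S. S \<subseteq> V \<and> card S \<le> 0} = {{}}" using assms by (auto dest: finite_subset)
  then show ?case by simp
next
  case (Suc n)
  let ?g = "\<lambda>(x, S). case x of None \<Rightarrow> S | Some v \<Rightarrow> insert v S"
  let ?D = "insert None (Some ` V) \<times> {S. S \<subseteq> V \<and> card S \<le> n}"
  have fin: "finite ?D" using assms by simp
  have "{S. S \<subseteq> V \<and> card S \<le> Suc n} \<subseteq> ?g ` ?D"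
  proof
    fix S assume "S \<in> {S. S \<subseteq> V \<and> card S \<le> Suc n}"
    then have S: "S \<subseteq> V" "card S \<le> Suc n" by auto
    show "S \<in> ?g ` ?D"
    proof (cases "card S \<le> n")
      case True
      then show ?thesis using S by (intro image_eqI[of _ _ "(None, S)"]) auto
    next
      case False
      then obtain v where v: "v \<in> S" by fastforce
      have "card (S - {v}) \<le> n"
        using v S assms by (simp add: card_Diff_singleton_if)
      then show ?thesis using S v by (intro image_eqI[of _ _ "(Some v, S - {v})"]) auto
    qed
  qed
  then have "card {S. S \<subseteq> V \<and> card S \<le> Suc n} \<le> card ?D"
    using fin by (rule surj_card_le[rotated])
  also have "\<dots> = (card V + 1) * card {S. S \<subseteq> V \<and> card S \<le> n}"
    using assms by (simp add: card_cartesian_product card_insert_if card_image image_iff)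
  also have "\<dots> \<le> (card V + 1) * (card V + 1) ^ n" using Suc by (intro mult_left_mono) auto
  finally show ?case by simp
qed

text \<open>Bijections between corresponding fibers glue together: the value of \<open>g\<close> at
  the image tells which fiber a point came from, so the glued map is injective, hence onto the
  finite set \<open>Q\<close>. It later supplies the permutation of components.\<close>

lemma ex_bij_betw_fibers:
  assumes fin: "finite Q"
    and fibers: "\<And>t. card {x \<in> Q. f x = t} = card {x \<in> Q. g x = t}"
  shows "\<exists>h. bij_betw h Q Q \<and> (\<forall>x\<in>Q. g (h x) = f x)"
proof -
  have "\<exists>h. bij_betw h {x \<in> Q. f x = t} {x \<in> Q. g x = t}" for t
    using fin fibers by (intro finite_same_card_bij) auto
  then obtain h where h: "bij_betw (h t) {x \<in> Q. f x = t} {x \<in> Q. g x = t}" for t by metis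
  have in_fiber: "h (f x) x \<in> Q \<and> g (h (f x) x) = f x" if "x \<in> Q" for x
    using bij_betwE[OF h[of "f x"]] that by auto
  have "inj_on (\<lambda>x. h (f x) x) Q"
  proof (rule inj_onI)
    fix x y assume xy: "x \<in> Q" "y \<in> Q" "h (f x) x = h (f y) y"
    then have "f x = f y" using in_fiber by metis
    then show "x = y" using xy bij_betw_imp_inj_on[OF h[of "f y"]] by (auto dest: inj_onD)
  qed
  moreover from this have "(\<lambda>x. h (f x) x) ` Q = Q"
    using in_fiber by (intro endo_inj_surj[OF fin]) auto
  ultimately have "bij_betw (\<lambda>x. h (f x) x) Q Q" by (simp add: bij_betw_def)
  then show ?thesis using in_fiber by (intro exI[of _ "\<lambda>x. h (f x) x"]) auto
qed

section \<open>Counting connected graphs with few possible neighbourhoods\<close>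

text \<open>
  Each letter of the word specifies the out-neighbourhood of the vertex explored next, which is
  chosen among the known unexplored ones by a rule that depends on the explored part only.
\<close>

fun explore :: "'l \<Rightarrow> ('l \<Rightarrow> 'c \<Rightarrow> 'l set) \<Rightarrow> 'c list \<Rightarrow> 'l set \<times> 'l rel" where
  "explore r nb [] = ({}, {})"
| "explore r nb (c # cs) = (let (D, E) = explore r nb cs; R = insert r (Range E) - D in
     if R = {} then (D, E)
     else let x = (SOME x. x \<in> R) in (insert x D, E \<union> {x} \<times> nb x c))"

text \<open>Invariant of the exploration: \<open>D\<close> is the explored part and the relation
  holds exactly the arcs leaving it. Words are consumed from the tail, so a further step puts its
  letter in front.\<close>

lemma explore_prefix:
  assumes fin: "finite L" and E: "E \<subseteq> L \<times> L" and r: "r \<in> L"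
    and reach: "L \<subseteq> E\<^sup>* `` {r}"
    and nb: "\<And>x. x \<in> L \<Longrightarrow> \<exists>c\<in>C. E `` {x} = nb x c"
  shows "\<exists>cs D. length cs = i \<and> set cs \<subseteq> C \<and> D \<subseteq> L \<and> card D = min i (card L) \<and>
    explore r nb cs = (D, E \<inter> D \<times> UNIV)"
proof (induction i)
  case 0
  show ?case by (intro exI[of _ "[]"] exI[of _ "{}"]) auto
next
  case (Suc i)
  then obtain cs D where cs: "length cs = i" "set cs \<subseteq> C" "D \<subseteq> L" "card D = min i (card L)"
    "explore r nb cs = (D, E \<inter> D \<times> UNIV)" by auto
  define R where "R = insert r (Range (E \<inter> D \<times> UNIV)) - D"
  show ?case
  proof (cases "R = {}")
    case True
    \<comment> \<open>With no known vertex left unexplored, \<open>D\<close> contains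
      \<open>r\<close> and is closed under arcs.\<close>
    have "x \<in> D" if "(r, x) \<in> E\<^sup>*" for x
      using that by induction (use True in \<open>auto simp: R_def\<close>)
    then have "D = L" using reach cs(3) by auto
    then have "i \<ge> card L" using cs(4) by simp
    \<comment> \<open>Any letter serves as padding, since the exploration has finished.\<close>
    obtain c where "c \<in> C" using nb r by auto
    moreover have "explore r nb (c # cs) = (D, E \<inter> D \<times> UNIV)"
      using cs(5) True unfolding R_def by (simp only: explore.simps Let_def prod.case) simp
    ultimately show ?thesis using cs \<open>D = L\<close> \<open>i \<ge> card L\<close>
      by (intro exI[of _ "c # cs"] exI[of _ D]) (simp del: explore.simps)
  next
    case False
    define x where "x = (SOME x. x \<in> R)"
    have xR: "x \<in> R" unfolding x_def using False by (simp add: some_in_eq)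
    then have x: "x \<in> L" "x \<notin> D" using r E by (auto simp: R_def)
    obtain c where c: "c \<in> C" "E `` {x} = nb x c" using nb x by auto
    have "card (insert x D) \<le> card L" using x cs(3) fin by (intro card_mono) auto
    then have "card (insert x D) = min (Suc i) (card L)"
      using x cs(3,4) fin by (auto simp: card_insert_if finite_subset)
    moreover have "explore r nb (c # cs) = (insert x D, E \<inter> insert x D \<times> UNIV)"
      using cs(5) False c(2) unfolding x_def R_def
      by (simp only: explore.simps Let_def prod.case if_False) auto
    ultimately show ?thesis using cs x c
      by (intro exI[of _ "c # cs"] exI[of _ "insert x D"]) (simp del: explore.simps)
  qed
qed

text \<open>Padding makes one fixed length \<open>n\<close> suffice for all graphs with at most
  \<open>n\<close> vertices.\<close>

lemma explore_surj:
  assumes fin: "finite L" and E: "E \<subseteq> L \<times> L" and r: "r \<in> L"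
    and reach: "L \<subseteq> E\<^sup>* `` {r}"
    and nb: "\<And>x. x \<in> L \<Longrightarrow> \<exists>c\<in>C. E `` {x} = nb x c"
    and n: "card L \<le> n"
  shows "(L, E) \<in> explore r nb ` {cs. set cs \<subseteq> C \<and> length cs = n}"
proof -
  obtain cs D where cs: "length cs = n" "set cs \<subseteq> C" "D \<subseteq> L" "card D = min n (card L)"
    "explore r nb cs = (D, E \<inter> D \<times> UNIV)"
    using explore_prefix[OF fin E r reach nb, of n] by auto
  have "D = L" using cs(3,4) n fin by (intro card_subset_eq) auto
  moreover have "E \<inter> L \<times> UNIV = E" using E by auto
  ultimately show ?thesis using cs by (intro image_eqI[of _ _ cs]) auto
qed

section \<open>Graphs drawn on a grid\<close>

text \<open>Intersecting unit disks have centres at distance at most 2, so the floors of each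
  coordinate differ by at most 2.\<close>

definition offsets :: "(int \<times> int) set" where
  "offsets = {-2..2} \<times> {-2..2}"

lemma offsets: "finite offsets" "card offsets = 25" "(0, 0) \<in> offsets"
  by (auto simp: offsets_def card_cartesian_product)

text \<open>These are the only consequences of the embedding that the counting uses.
  \<open>idx\<close> numbers the vertices of each cell from 0, so cell and index together are
  coordinates of a vertex.\<close>

locale grid_graph =
  fixes P :: "'a pair_pre_digraph" and cell :: "'a \<Rightarrow> int \<times> int" and idx :: "'a \<Rightarrow> nat"
    and p :: nat
  assumes finite_verts: "finite (pverts P)"
    and arcs_subset: "parcs P \<subseteq> pverts P \<times> pverts P"
    and sym_arcs: "sym (parcs P)"
    and same_cell: "\<lbrakk>u \<in> pverts P; v \<in> pverts P; u \<noteq> v; cell u = cell v\<rbrakk> \<Longrightarrow> (u, v) \<in> parcs P"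
    and adj_offset: "(u, v) \<in> parcs P \<Longrightarrow> cell v - cell u \<in> offsets"
    and idx_less: "v \<in> pverts P \<Longrightarrow> idx v < p"
    and idx_inj: "inj_on (\<lambda>v. (cell v, idx v)) (pverts P)"
    and idx_zero: "v \<in> pverts P \<Longrightarrow> \<exists>w\<in>pverts P. cell w = cell v \<and> idx w = 0"
begin

abbreviation "V \<equiv> pverts P"
abbreviation "E \<equiv> parcs P"

section \<open>Connected components\<close>

definition conn_comp :: "'a \<Rightarrow> 'a set" where
  "conn_comp u = E\<^sup>* `` {u}"

definition comps :: "'a set set" where
  "comps = conn_comp ` V"

lemma self_in_conn_comp: "u \<in> conn_comp u"
  by (simp add: conn_comp_def)

lemma conn_comp_eq: "v \<in> conn_comp u \<Longrightarrow> conn_comp v = conn_comp u"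
proof -
  assume "v \<in> conn_comp u"
  then have "(u, v) \<in> E\<^sup>*" by (simp add: conn_comp_def)
  moreover from this have "(v, u) \<in> E\<^sup>*" using sym_rtrancl[OF sym_arcs] by (auto dest: symD)
  ultimately show ?thesis by (auto simp: conn_comp_def)
qed

lemma conn_comp_eq_iff: "conn_comp u = conn_comp v \<longleftrightarrow> v \<in> conn_comp u"
  using conn_comp_eq self_in_conn_comp by metis

lemma conn_comp_adj: "(u, v) \<in> E \<Longrightarrow> conn_comp v = conn_comp u"
  by (rule conn_comp_eq) (auto simp: conn_comp_def)

lemma conn_comp_subset: "u \<in> V \<Longrightarrow> conn_comp u \<subseteq> V"
proof
  fix v assume "v \<in> conn_comp u" and u: "u \<in> V"
  then have "(u, v) \<in> E\<^sup>*" by (simp add: conn_comp_def)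
  then show "v \<in> V" by induction (use u arcs_subset in auto)
qed

lemma conn_comp_in_comps: "u \<in> V \<Longrightarrow> conn_comp u \<in> comps"
  by (simp add: comps_def)

lemma compsD: "K \<in> comps \<Longrightarrow> u \<in> K \<Longrightarrow> conn_comp u = K \<and> u \<in> V"
  using conn_comp_eq conn_comp_subset by (fastforce simp: comps_def)

lemma finite_comps: "finite comps" "card comps \<le> card V"
  using finite_verts by (auto simp: comps_def card_image_le)

lemma finite_comp: "K \<in> comps \<Longrightarrow> finite K"
  using conn_comp_subset finite_verts by (auto simp: comps_def intro: finite_subset)

lemma conn_comp_cell: "u \<in> V \<Longrightarrow> v \<in> V \<Longrightarrow> cell u = cell v \<Longrightarrow> conn_comp u = conn_comp v"
  using same_cell conn_comp_adj by metis

section \<open>Labelled components and the number of their types\<close>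

definition root :: "'a set \<Rightarrow> 'a" where
  "root K = (SOME v. v \<in> K \<and> idx v = 0)"

lemma root: "K \<in> comps \<Longrightarrow> root K \<in> K \<and> idx (root K) = 0"
proof -
  assume K: "K \<in> comps"
  then obtain u where u: "u \<in> V" "K = conn_comp u" by (auto simp: comps_def)
  obtain w where w: "w \<in> V" "cell w = cell u" "idx w = 0" using idx_zero u by blast
  then have "w \<in> K" using conn_comp_cell u self_in_conn_comp by metis
  then show ?thesis
    unfolding root_def using w someI[of "\<lambda>v. v \<in> K \<and> idx v = 0" w] by simp
qed

text \<open>Measuring cells from the root makes labels invariant under translation, and a root of
  index 0 gets the label \<open>((0, 0), 0)\<close> in every component, which is where the
  exploration starts.\<close>

definition lab :: "'a \<Rightarrow> (int \<times> int) \<times> nat" where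
  "lab u = (cell u - cell (root (conn_comp u)), idx u)"

lemma lab_inj: "u \<in> V \<Longrightarrow> v \<in> V \<Longrightarrow> conn_comp u = conn_comp v \<Longrightarrow> lab u = lab v \<Longrightarrow> u = v"
  using idx_inj by (auto simp: lab_def dest: inj_onD)

text \<open>This serves as the isomorphism type. It may be finer than isomorphism, which is
  harmless: equal values yield an isomorphism that matches labels, and the number of values is
  bounded directly.\<close>

definition comp_graph :: "'a set \<Rightarrow> ((int \<times> int) \<times> nat) set \<times> ((int \<times> int) \<times> nat) rel" where
  "comp_graph K = (lab ` K, map_prod lab lab ` (E \<inter> K \<times> K))"

lemma comp_graph_arc_iff:
  assumes "K \<in> comps" "u \<in> K" "v \<in> K"
  shows "(u, v) \<in> E \<longleftrightarrow> (lab u, lab v) \<in> snd (comp_graph K)"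
proof
  assume "(u, v) \<in> E"
  then have "(u, v) \<in> E \<inter> K \<times> K" using assms by simp
  then show "(lab u, lab v) \<in> snd (comp_graph K)"
    unfolding comp_graph_def snd_conv by (rule map_prod_imageI)
next
  assume "(lab u, lab v) \<in> snd (comp_graph K)"
  then obtain u' v' where uv: "(u', v') \<in> E" "u' \<in> K" "v' \<in> K" "lab u = lab u'" "lab v = lab v'"
    unfolding comp_graph_def snd_conv by (elim prod_fun_imageE) auto
  then have "u = u'" "v = v'" using lab_inj compsD[OF assms(1)] assms(2,3) by simp_all
  then show "(u, v) \<in> E" using uv by simp
qed

definition shift :: "(int \<times> int) \<times> nat \<Rightarrow> ((int \<times> int) \<times> nat) set \<Rightarrow> ((int \<times> int) \<times> nat) set" where
  "shift x c = (\<lambda>(d, j). (fst x + d, j)) ` c"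

text \<open>A component is explored from its root. The letter of a vertex lists its neighbours by
  cell offset and index, and \<open>shift\<close> converts these into labels because all labels
  refer to the same root.\<close>

lemma comp_graph_in_explore:
  assumes K: "K \<in> comps" and n: "card K \<le> n"
  shows "comp_graph K \<in> explore ((0, 0), 0) shift `
    {cs. set cs \<subseteq> Pow (offsets \<times> {..<p}) \<and> length cs = n}"
  unfolding comp_graph_def
proof (rule explore_surj)
  let ?E = "map_prod lab lab ` (E \<inter> K \<times> K)"
  have rt: "root K \<in> K" "idx (root K) = 0" using root K by auto
  have compK: "conn_comp u = K" "u \<in> V" if "u \<in> K" for u using compsD K that by auto
  have labr: "lab (root K) = ((0, 0), 0)" using rt compK by (simp add: lab_def zero_prod_def)
  show "finite (lab ` K)" using finite_comp K by simp
  show "?E \<subseteq> lab ` K \<times> lab ` K" by auto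
  show "((0, 0), 0) \<in> lab ` K" using labr rt by (metis imageI)
  show "card (lab ` K) \<le> n" using card_image_le[OF finite_comp[OF K], of lab] n by simp
  show "lab ` K \<subseteq> ?E\<^sup>* `` {((0, 0), 0)}"
  proof
    fix x assume "x \<in> lab ` K"
    then obtain u where u: "u \<in> K" "x = lab u" by auto
    have "u \<in> conn_comp (root K)" using rt u compK self_in_conn_comp by metis
    then have "(root K, u) \<in> E\<^sup>*" by (simp add: conn_comp_def)
    then have "(lab (root K), lab u) \<in> ?E\<^sup>*"
    proof induction
      case (step y z)
      have "y \<in> K" using step(1) compK(1)[OF rt(1)] by (auto simp: conn_comp_def)
      moreover have "z \<in> K" using step(2) conn_comp_adj self_in_conn_comp[of z] compK(1)[OF \<open>y \<in> K\<close>] by auto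
      ultimately have "(lab y, lab z) \<in> ?E" using step(2) by force
      then show ?case using step(3) by (rule rtrancl_into_rtrancl[rotated])
    qed simp
    then show "x \<in> ?E\<^sup>* `` {((0, 0), 0)}" using labr u by simp
  qed
  fix x assume "x \<in> lab ` K"
  then obtain u where u: "u \<in> K" "x = lab u" by auto
  \<comment> \<open>The letter that the exploration reads at \<open>u\<close>.\<close>
  let ?c = "(\<lambda>v. (cell v - cell u, idx v)) ` (E `` {u})"
  have "?c \<in> Pow (offsets \<times> {..<p})"
    using adj_offset idx_less arcs_subset by auto
  moreover have "?E `` {x} = shift x ?c"
  proof -
    have nbK: "v \<in> K" if "(u, v) \<in> E" for v
      using conn_comp_adj[OF that] compK(1)[OF u(1)] self_in_conn_comp[of v] by simp
    have "?E `` {x} = lab ` (E `` {u})"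
    proof
      show "?E `` {x} \<subseteq> lab ` (E `` {u})"
      proof
        fix y assume "y \<in> ?E `` {x}"
        then have "(lab u, y) \<in> ?E" using u(2) by simp
        then obtain u' v where uv: "(u', v) \<in> E" "u' \<in> K" "lab u = lab u'" "y = lab v"
          by (elim prod_fun_imageE) auto
        then have "u = u'" using lab_inj compK u(1) by simp
        then show "y \<in> lab ` (E `` {u})" using uv by simp
      qed
      show "lab ` (E `` {u}) \<subseteq> ?E `` {x}"
      proof
        fix y assume "y \<in> lab ` (E `` {u})"
        then obtain v where v: "(u, v) \<in> E" "y = lab v" by auto
        then have "(u, v) \<in> E \<inter> K \<times> K" using u(1) nbK by simp
        then have "(lab u, lab v) \<in> ?E" by (rule map_prod_imageI)
        then show "y \<in> ?E `` {x}" using u(2) v(2) by simp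
      qed
    qed
    also have "\<dots> = shift x ?c"
      unfolding shift_def image_image
      using u nbK compK by (intro image_cong) (auto simp: lab_def)
    finally show ?thesis .
  qed
  ultimately show "\<exists>c\<in>Pow (offsets \<times> {..<p}). ?E `` {x} = shift x c" by blast
qed

lemma card_comp_graphs_small:
  "card (comp_graph ` {K \<in> comps. card K \<le> n}) \<le> 2 ^ (25 * p * n)"
proof -
  let ?W = "{cs. set cs \<subseteq> Pow (offsets \<times> {..<p}) \<and> length cs = n}"
  have fin: "finite (Pow (offsets \<times> {..<p}))" using offsets by simp
  have "card (comp_graph ` {K \<in> comps. card K \<le> n}) \<le> card ?W"
    by (rule surj_card_le[of _ _ "explore ((0, 0), 0) shift"])
      (use comp_graph_in_explore finite_lists_length_eq[OF fin] in auto)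
  also have "card ?W = (2 ^ (25 * p)) ^ n"
    using card_lists_length_eq[OF fin, of n] offsets
    by (simp add: card_Pow card_cartesian_product)
  finally show ?thesis by (simp add: power_mult)
qed

section \<open>Sides of a separation and the data that determine them\<close>

lemma separation_Un: "separation P (A, B) \<Longrightarrow> A \<union> B = V"
  by (simp add: separation_def)

lemma separation_side:
  assumes "separation P (A, B)" "(u, v) \<in> E" "u \<notin> A \<inter> B" "v \<notin> A \<inter> B"
  shows "u \<in> A \<longleftrightarrow> v \<in> A"
  using assms arcs_subset by (auto simp: separation_def)

text \<open>No arc joins the two sides outside \<open>A \<inter> B\<close>, so the side stays
  constant along every path in a component that avoids the separator.\<close>

lemma separation_side_comp:
  assumes "separation P (A, B)" "K \<in> comps" "K \<inter> (A \<inter> B) = {}" "u \<in> K"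
  shows "u \<in> A \<longleftrightarrow> K \<subseteq> A"
proof -
  have "v \<in> A \<longleftrightarrow> u \<in> A" if "v \<in> K" for v
  proof -
    have "(u, v) \<in> E\<^sup>*" using compsD[OF assms(2)] that assms(4) by (auto simp: conn_comp_def)
    then show ?thesis
    proof induction
      case (step y z)
      have "conn_comp y = K" using step(1) compsD[OF assms(2,4)] conn_comp_eq[of y u]
        by (auto simp: conn_comp_def)
      then have "y \<in> K" "z \<in> K" using self_in_conn_comp conn_comp_adj[OF step(2)] by blast+
      then show ?case using separation_side[OF assms(1) step(2)] step(3) assms(3) by auto
    qed simp
  qed
  then show ?thesis using assms(4) by blast
qed

text \<open>One bit per separator vertex and offset, instead of one per neighbour, keeps the cost at
  25 bits per separator vertex, independently of the ply.\<close>

definition near :: "'a set \<Rightarrow> 'a set \<Rightarrow> ('a \<times> int \<times> int) set" where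
  "near A B = {(v, d). v \<in> A \<inter> B \<and> d \<in> offsets \<and> (\<exists>w\<in>A - B. cell w = cell v + d)}"

text \<open>
  Vertices outside \<open>A \<inter> B\<close> that lie in a common cell are adjacent and hence on the same side.
\<close>

lemma near_iff:
  assumes "separation P (A, B)" "(y, z) \<in> E" "y \<in> A \<inter> B" "z \<notin> A \<inter> B"
  shows "z \<in> A \<longleftrightarrow> (y, cell z - cell y) \<in> near A B"
proof
  assume "z \<in> A"
  then show "(y, cell z - cell y) \<in> near A B"
    using assms adj_offset by (auto simp: near_def)
next
  assume "(y, cell z - cell y) \<in> near A B"
  then obtain w where w: "w \<in> A - B" "cell w = cell z" by (auto simp: near_def)
  have "w \<in> V" "z \<in> V" using w separation_Un[OF assms(1)] assms(2) arcs_subset by auto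
  then have "w = z \<or> (w, z) \<in> E" using same_cell w(2) by blast
  then show "z \<in> A" using separation_side[OF assms(1), of w z] w(1) assms(4) by auto
qed

text \<open>Follow a path from a separator vertex to \<open>v\<close>. A step that leaves the
  separator is decided by \<open>near\<close>, a step outside it keeps the side in both separations,
  and separator vertices lie in both \<open>A\<close> and \<open>A'\<close>.\<close>

lemma near_determines_side:
  assumes sep: "separation P (A, B)" "separation P (A', B')"
    and S: "A' \<inter> B' = A \<inter> B" and near: "near A' B' = near A B"
    and touch: "conn_comp v \<inter> (A \<inter> B) \<noteq> {}"
  shows "v \<in> A \<longleftrightarrow> v \<in> A'"
proof -
  obtain r where r: "r \<in> A \<inter> B" "r \<in> conn_comp v" using touch by blast
  then have "v \<in> conn_comp r" using conn_comp_eq_iff by metis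
  then have "(r, v) \<in> E\<^sup>*" by (simp add: conn_comp_def)
  then show ?thesis
  proof induction
    case base
    then show ?case using r S by auto
  next
    case (step y z)
    consider "z \<in> A \<inter> B" | "z \<notin> A \<inter> B" "y \<notin> A \<inter> B" | "z \<notin> A \<inter> B" "y \<in> A \<inter> B" by blast
    then show ?case
    proof cases
      case 1
      then show ?thesis using S by auto
    next
      case 2
      then have "y \<in> A \<longleftrightarrow> z \<in> A" using separation_side[OF sep(1) step(2)] by blast
      moreover have "y \<in> A' \<longleftrightarrow> z \<in> A'" using separation_side[OF sep(2) step(2)] 2 S by blast
      ultimately show ?thesis using step(3) by blast
    next
      case 3
      then have "z \<in> A \<longleftrightarrow> (y, cell z - cell y) \<in> near A B"
        using near_iff[OF sep(1) step(2)] by blast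
      moreover have "z \<in> A' \<longleftrightarrow> (y, cell z - cell y) \<in> near A B"
        using near_iff[OF sep(2) step(2)] 3 S near by blast
      ultimately show ?thesis by blast
    qed
  qed
qed

section \<open>Isomorphisms between separations with equal data\<close>

definition free_comps :: "'a set set \<Rightarrow> 'a set \<Rightarrow> 'a set set" where
  "free_comps Big S = {K \<in> comps - Big. K \<inter> S = {}}"

text \<open>Only free components need counting: the side of any other component is either recorded
  through \<open>Big\<close> or determined by \<open>near\<close>.\<close>

definition free_count ::
    "'a set set \<Rightarrow> 'a set \<Rightarrow> 'a set \<Rightarrow> ((int \<times> int) \<times> nat) set \<times> ((int \<times> int) \<times> nat) rel \<Rightarrow> nat" where
  "free_count Big A B t = card {K \<in> free_comps Big (A \<inter> B). comp_graph K = t \<and> K \<subseteq> A}"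

lemma finite_free_comps: "finite (free_comps Big S)"
  using finite_comps(1) by (simp add: free_comps_def)

text \<open>Sending each vertex to the vertex with the same label in the image of its component
  turns the permutation \<open>\<pi>\<close> into a graph automorphism. Components meeting the
  separator are fixed pointwise, since labels are injective on a component.\<close>

lemma sep_isomorphic_if_permutation:
  assumes sep: "separation P (A, B)" "separation P (A', B')"
    and S: "A' \<inter> B' = A \<inter> B"
    and \<pi>: "inj_on \<pi> comps" "\<And>K. K \<in> comps \<Longrightarrow> \<pi> K \<in> comps"
    and graph: "\<And>K. K \<in> comps \<Longrightarrow> comp_graph (\<pi> K) = comp_graph K"
    and fixed: "\<And>K. K \<in> comps \<Longrightarrow> K \<inter> (A \<inter> B) \<noteq> {} \<Longrightarrow> \<pi> K = K"
    and side: "\<And>K. K \<in> comps \<Longrightarrow> K \<inter> (A \<inter> B) = {} \<Longrightarrow> \<pi> K \<subseteq> A' \<longleftrightarrow> K \<subseteq> A"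
    and touch: "\<And>K u. K \<in> comps \<Longrightarrow> K \<inter> (A \<inter> B) \<noteq> {} \<Longrightarrow> u \<in> K \<Longrightarrow> u \<in> A \<longleftrightarrow> u \<in> A'"
  shows "sep_isomorphic P (A, B) (A', B')"
proof -
  define f where "f u = (SOME w. w \<in> \<pi> (conn_comp u) \<and> lab w = lab u)" for u
  have "f u \<in> \<pi> (conn_comp u) \<and> lab (f u) = lab u" if "u \<in> V" for u
  proof -
    have "lab ` \<pi> (conn_comp u) = lab ` conn_comp u"
      using graph[OF conn_comp_in_comps[OF that]] by (simp add: comp_graph_def)
    then obtain w where "w \<in> \<pi> (conn_comp u)" "lab w = lab u"
      using self_in_conn_comp[of u] by (metis imageE imageI)
    then show ?thesis unfolding f_def
      using someI[of "\<lambda>w. w \<in> \<pi> (conn_comp u) \<and> lab w = lab u" w] by simp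
  qed
  then have f: "f u \<in> \<pi> (conn_comp u)" "lab (f u) = lab u" if "u \<in> V" for u using that by auto
  have comp_f: "conn_comp (f u) = \<pi> (conn_comp u)" "f u \<in> V" if "u \<in> V" for u
    using compsD[OF \<pi>(2)[OF conn_comp_in_comps[OF that]] f(1)[OF that]] by auto
  have comp_f_eq: "conn_comp u = conn_comp v"
    if "u \<in> V" "v \<in> V" "conn_comp (f u) = conn_comp (f v)" for u v
    using that comp_f \<pi>(1) conn_comp_in_comps by (metis inj_onD)
  have f_fixed: "f u = u" if "u \<in> V" "conn_comp u \<inter> (A \<inter> B) \<noteq> {}" for u
  proof (rule lab_inj[OF comp_f(2)[OF that(1)] that(1)])
    show "conn_comp (f u) = conn_comp u"
      using comp_f(1)[OF that(1)] fixed[OF conn_comp_in_comps[OF that(1)] that(2)] by (rule trans)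
    show "lab (f u) = lab u" using f(2)[OF that(1)] .
  qed
  have "inj_on f V"
  proof (rule inj_onI)
    fix u v assume uv: "u \<in> V" "v \<in> V" "f u = f v"
    then have "conn_comp u = conn_comp v" using comp_f_eq[OF uv(1,2)] by simp
    moreover have "lab u = lab v" using f(2)[OF uv(1)] f(2)[OF uv(2)] uv(3) by simp
    ultimately show "u = v" by (rule lab_inj[OF uv(1,2)])
  qed
  moreover have fV: "f ` V = V"
    using comp_f(2) calculation by (intro endo_inj_surj finite_verts) auto
  ultimately have bij: "bij_betw f V V" by (simp add: bij_betw_def)
  have arcs: "(u, v) \<in> E \<longleftrightarrow> (f u, f v) \<in> E" if uv: "u \<in> V" "v \<in> V" for u v
  proof (cases "conn_comp u = conn_comp v")
    case True
    let ?K = "conn_comp u"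
    have K: "?K \<in> comps" "u \<in> ?K" "v \<in> ?K"
      using conn_comp_in_comps uv self_in_conn_comp True by auto
    have "f u \<in> \<pi> ?K" "f v \<in> \<pi> ?K" using f(1)[OF uv(1)] f(1)[OF uv(2)] True by auto
    then show ?thesis
      using comp_graph_arc_iff[OF K] comp_graph_arc_iff[OF \<pi>(2)[OF K(1)]] graph[OF K(1)]
        f(2)[OF uv(1)] f(2)[OF uv(2)] by simp
  next
    case False
    then have "conn_comp (f u) \<noteq> conn_comp (f v)" using comp_f_eq uv by blast
    \<comment> \<open>Distinct components have distinct images, so there is no arc before or after
      applying \<open>f\<close>.\<close>
    then show ?thesis using False conn_comp_adj by metis
  qed
  have f_mem: "(f u \<in> A' \<longleftrightarrow> u \<in> A) \<and> (f u \<in> A \<inter> B \<longleftrightarrow> u \<in> A \<inter> B)" if u: "u \<in> V" for u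
  proof (cases "conn_comp u \<inter> (A \<inter> B) = {}")
    case False
    then show ?thesis
      using f_fixed[OF u] touch[OF conn_comp_in_comps[OF u] False self_in_conn_comp] by simp
  next
    case True
    let ?K = "conn_comp u"
    have K: "?K \<in> comps" "u \<in> ?K" using conn_comp_in_comps u self_in_conn_comp by auto
    \<comment> \<open>\<open>\<pi>\<close> is injective and fixes the components meeting
      \<open>A \<inter> B\<close>, so it sends no other component onto one of them.\<close>
    have disj: "\<pi> ?K \<inter> (A \<inter> B) = {}"
      using fixed[OF \<pi>(2)[OF K(1)]] True inj_onD[OF \<pi>(1) _ \<pi>(2)[OF K(1)] K(1)] by metis
    have "f u \<in> A' \<longleftrightarrow> \<pi> ?K \<subseteq> A'"
      using separation_side_comp[OF sep(2) \<pi>(2)[OF K(1)]] disj f(1)[OF u] S by simp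
    also have "\<dots> \<longleftrightarrow> u \<in> A"
      using side[OF K(1) True] separation_side_comp[OF sep(1) K(1) True K(2)] by simp
    finally show ?thesis using f(1)[OF u] disj True self_in_conn_comp[of u] by blast
  qed
  have sub: "A \<union> B = V" "A' \<union> B' = V" using separation_Un sep by auto
  \<comment> \<open>As \<open>A \<union> B = V\<close>, membership in \<open>B\<close> follows from
    membership in \<open>A\<close> and in \<open>A \<inter> B\<close>; likewise for the primed
    sets.\<close>
  have f_mem_B: "f u \<in> B' \<longleftrightarrow> u \<in> B" if "u \<in> V" for u
    using f_mem[OF that] sub S that comp_f(2)[OF that] by blast
  have img: "f ` X = Y" if XY: "X \<subseteq> V" "Y \<subseteq> V" "\<And>u. u \<in> V \<Longrightarrow> f u \<in> Y \<longleftrightarrow> u \<in> X"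
    for X Y
  proof
    show "f ` X \<subseteq> Y" using XY by auto
    show "Y \<subseteq> f ` X"
    proof
      fix y assume "y \<in> Y"
      then obtain u where "u \<in> V" "y = f u" using fV XY(2) by blast
      then show "y \<in> f ` X" using XY(3) \<open>y \<in> Y\<close> by auto
    qed
  qed
  have "f ` A = A'" using sub f_mem by (intro img) auto
  moreover have "f ` B = B'" using sub f_mem_B by (intro img) auto
  moreover have "f u = u" if "u \<in> A \<inter> B" for u
    using f_fixed[of u] that sub self_in_conn_comp[of u] by blast
  ultimately show ?thesis
    unfolding sep_isomorphic_def prod.case using bij arcs by (intro exI[of _ f]) simp
qed

text \<open>Free components of the same type are interchangeable, so equal counts allow permuting
  them until their sides agree. All other components stay in place, where \<open>near\<close> and
  \<open>Big\<close> already fix the sides.\<close>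

lemma sep_isomorphicI:
  assumes sep: "separation P (A, B)" "separation P (A', B')"
    and S: "A' \<inter> B' = A \<inter> B" and near: "near A' B' = near A B"
    and big: "{K \<in> Big. K \<subseteq> A'} = {K \<in> Big. K \<subseteq> A}"
    and count: "\<And>t. free_count Big A' B' t = free_count Big A B t"
  shows "sep_isomorphic P (A, B) (A', B')"
proof -
  define Q where "Q = free_comps Big (A \<inter> B)"
  have finQ: "finite Q" unfolding Q_def by (rule finite_free_comps)
  \<comment> \<open>Each free component is tagged with its type and its side. Counts for side
    \<open>A\<close> agree by assumption, those for the other side by complement within the
    type.\<close>
  have "card {K \<in> Q. (comp_graph K, K \<subseteq> A) = tb} = card {K \<in> Q. (comp_graph K, K \<subseteq> A') = tb}" for tb
  proof -
    obtain t b where tb: "tb = (t, b)" by (cases tb)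
    have cnt: "card {K \<in> Q. comp_graph K = t \<and> K \<subseteq> A} = card {K \<in> Q. comp_graph K = t \<and> K \<subseteq> A'}"
      using count[of t] S by (simp add: free_count_def Q_def)
    have compl: "card {K \<in> Q. comp_graph K = t \<and> \<not> K \<subseteq> X} =
        card {K \<in> Q. comp_graph K = t} - card {K \<in> Q. comp_graph K = t \<and> K \<subseteq> X}" for X
    proof -
      have "{K \<in> Q. comp_graph K = t \<and> \<not> K \<subseteq> X} =
        {K \<in> Q. comp_graph K = t} - {K \<in> Q. comp_graph K = t \<and> K \<subseteq> X}" by auto
      then show ?thesis using finQ by (simp add: card_Diff_subset Collect_mono)
    qed
    show ?thesis using cnt compl[of A] compl[of A'] tb by (cases b) simp_all
  qed
  from ex_bij_betw_fibers[OF finQ this] obtain h where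
    h: "bij_betw h Q Q" "\<And>K. K \<in> Q \<Longrightarrow> comp_graph (h K) = comp_graph K"
      "\<And>K. K \<in> Q \<Longrightarrow> h K \<subseteq> A' \<longleftrightarrow> K \<subseteq> A" by auto
  have Q: "K \<in> Q \<longleftrightarrow> K \<in> comps \<and> K \<notin> Big \<and> K \<inter> (A \<inter> B) = {}" for K
    by (auto simp: Q_def free_comps_def)
  have hQ: "h K \<in> Q" if "K \<in> Q" for K using h(1) that by (rule bij_betw_apply)
  define \<pi> where "\<pi> K = (if K \<in> Q then h K else K)" for K
  show ?thesis
  proof (rule sep_isomorphic_if_permutation[OF sep S, of \<pi>])
    show "inj_on \<pi> comps"
      using bij_betw_imp_inj_on[OF h(1)] hQ by (auto simp: inj_on_def \<pi>_def split: if_splits)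
    show "\<pi> K \<in> comps" if "K \<in> comps" for K using that hQ Q by (simp add: \<pi>_def)
    show "comp_graph (\<pi> K) = comp_graph K" for K using h(2) by (simp add: \<pi>_def)
    show "\<pi> K = K" if "K \<inter> (A \<inter> B) \<noteq> {}" for K using that Q by (simp add: \<pi>_def)
    show "\<pi> K \<subseteq> A' \<longleftrightarrow> K \<subseteq> A" if "K \<in> comps" "K \<inter> (A \<inter> B) = {}" for K
      using that h(3) Q big by (auto simp: \<pi>_def)
    show "u \<in> A \<longleftrightarrow> u \<in> A'" if "K \<in> comps" "K \<inter> (A \<inter> B) \<noteq> {}" "u \<in> K" for K u
      using near_determines_side[OF sep S near, of u] compsD that by blast
  qed
qed

section \<open>Counting non-isomorphic separations by codes\<close>

lemma card_noniso_seps_le: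
  assumes Big: "Big \<subseteq> comps" and M: "M \<in> noniso_seps P (int n)"
  shows "card M \<le> (card V + 1) ^ n * 2 ^ (25 * n) * 2 ^ card Big *
    (card V + 1) ^ card (comp_graph ` (comps - Big))"
proof -
  define T where "T = comp_graph ` (comps - Big)"
  \<comment> \<open>Separations with equal codes are isomorphic, so \<open>code\<close> is injective
    on \<open>M\<close>. The four factors of the bound count the choices of
    \<open>A \<inter> B\<close>, of \<open>near A B\<close>, of the sides of \<open>Big\<close>, and
    of one number per remaining type.\<close>
  define code where "code X = (case X of (A, B) \<Rightarrow>
    ((A \<inter> B, near A B), {K \<in> Big. K \<subseteq> A}, restrict (free_count Big A B) T))" for X
  define \<S> where "\<S> = {S. S \<subseteq> V \<and> card S \<le> n}"
  define D where "D = (SIGMA S:\<S>. Pow (S \<times> offsets)) \<times> Pow Big \<times> (T \<rightarrow>\<^sub>E {..card V})"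
  have fin: "finite Big" "finite T" "finite \<S>"
    using Big finite_comps(1) finite_verts by (auto simp: T_def \<S>_def intro: finite_subset)
  have finS: "finite S" if "S \<in> \<S>" for S
    using that finite_verts by (auto simp: \<S>_def intro: finite_subset)
  have sepM: "separation P (A, B)" "card (A \<inter> B) \<le> n" if "(A, B) \<in> M" for A B
    using M that by (auto simp: noniso_seps_def sep_order_def)
  have "inj_on code M"
  proof (rule inj_onI, rule ccontr)
    fix X Y assume XY: "X \<in> M" "Y \<in> M" "code X = code Y" "X \<noteq> Y"
    obtain A B A' B' where AB: "X = (A, B)" "Y = (A', B')" by (cases X, cases Y)
    have eq: "A' \<inter> B' = A \<inter> B" "near A' B' = near A B" "{K \<in> Big. K \<subseteq> A'} = {K \<in> Big. K \<subseteq> A}"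
      "restrict (free_count Big A' B') T = restrict (free_count Big A B) T"
      using XY(3) by (simp_all add: code_def AB)
    have "free_count Big A' B' t = free_count Big A B t" for t
    proof (cases "t \<in> T")
      case True
      then show ?thesis using eq(4) by (metis restrict_apply')
    next
      case False
      \<comment> \<open>No free component has a type outside \<open>T\<close>, so both counts are
        0.\<close>
      then have none: "{K \<in> free_comps Big S. comp_graph K = t \<and> K \<subseteq> Z} = {}" for S Z
        by (auto simp: T_def free_comps_def)
      show ?thesis unfolding free_count_def none by simp
    qed
    then have "sep_isomorphic P X Y"
      unfolding AB using sepM XY(1,2) AB eq by (intro sep_isomorphicI) auto
    then show False using M XY by (auto simp: noniso_seps_def pairwise_def)
  qed
  moreover have "code ` M \<subseteq> D"
  proof
    fix y assume "y \<in> code ` M"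
    then obtain A B where AB: "(A, B) \<in> M" "y = code (A, B)" by auto
    have "A \<inter> B \<in> \<S>" using sepM[OF AB(1)] separation_Un by (auto simp: \<S>_def)
    moreover have "near A B \<subseteq> (A \<inter> B) \<times> offsets" by (auto simp: near_def)
    moreover have "free_count Big A B t \<le> card V" for t
    proof -
      have "free_count Big A B t \<le> card comps"
        unfolding free_count_def using finite_comps(1) by (intro card_mono) (auto simp: free_comps_def)
      then show ?thesis using finite_comps(2) by simp
    qed
    ultimately show "y \<in> D" by (auto simp: AB(2) code_def D_def)
  qed
  moreover have "finite D"
    unfolding D_def using fin finS offsets by (intro finite_cartesian_product finite_SigmaI finite_PiE) auto
  ultimately have "card M \<le> card D" by (rule card_inj_on_le)
  also have "card D = card (SIGMA S:\<S>. Pow (S \<times> offsets)) * 2 ^ card Big * (card V + 1) ^ card T"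
    unfolding D_def using fin by (simp add: card_cartesian_product card_Pow card_PiE)
  also have "card (SIGMA S:\<S>. Pow (S \<times> offsets)) \<le> (card V + 1) ^ n * 2 ^ (25 * n)"
  proof -
    have "card (SIGMA S:\<S>. Pow (S \<times> offsets)) = (\<Sum>S\<in>\<S>. card (Pow (S \<times> offsets)))"
      using fin finS offsets by (intro card_SigmaI) auto
    also have "\<dots> \<le> (\<Sum>S\<in>\<S>. 2 ^ (25 * n))"
    proof (rule sum_mono)
      fix S assume "S \<in> \<S>"
      then have "finite S" "card S \<le> n" by (rule finS, simp add: \<S>_def)
      then show "card (Pow (S \<times> offsets)) \<le> 2 ^ (25 * n)"
        using offsets by (simp add: card_Pow card_cartesian_product)
    qed
    also have "\<dots> = card \<S> * 2 ^ (25 * n)" by simp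
    also have "\<dots> \<le> (card V + 1) ^ n * 2 ^ (25 * n)"
      unfolding \<S>_def using card_subsets_card_le[OF finite_verts] by (intro mult_right_mono) auto
    finally show ?thesis .
  qed
  finally show ?thesis unfolding T_def by (simp add: mult_right_mono)
qed

lemma sigma_sep_le:
  assumes "Big \<subseteq> comps"
  shows "sigma_sep P (int n) \<le> (card V + 1) ^ n * 2 ^ (25 * n) * 2 ^ card Big *
    (card V + 1) ^ card (comp_graph ` (comps - Big))"
proof -
  have "{} \<in> noniso_seps P (int n)" by (simp add: noniso_seps_def)
  then have "noniso_seps P (int n) \<noteq> {}" by blast
  then show ?thesis
    unfolding sigma_sep_def
    using card_noniso_seps_le[OF assms] finite_noniso_seps(1)[OF finite_verts]
    by (intro Max.boundedI) auto
qed

text \<open>Components are disjoint, and each one counted has at least \<open>n + 1\<close>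
  vertices.\<close>

lemma card_big_comps: "card {K \<in> comps. n < card K} * Suc n \<le> card V"
proof -
  let ?B = "{K \<in> comps. n < card K}"
  have "card ?B * Suc n \<le> (\<Sum>K\<in>?B. card K)"
    using sum_bounded_below[of ?B "Suc n" card] by (simp add: Suc_le_eq)
  also have "\<dots> = card (\<Union>?B)"
  proof (rule card_Union_disjoint[symmetric])
    show "disjoint ?B"
      unfolding pairwise_def disjnt_def using compsD by blast
  qed (use finite_comp in auto)
  also have "\<dots> \<le> card V" using compsD finite_verts by (intro card_mono) auto
  finally show ?thesis .
qed

text \<open>Taking \<open>Big = comps\<close> leaves no type to count, and the side of the at most
  one component costs a factor 2.\<close>

lemma sigma_sep_le_if_one_comp:
  assumes "V \<subseteq> conn_comp r"
  shows "sigma_sep P (int n) \<le> (card V + 1) ^ n * 2 ^ (25 * n) * 2"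
proof -
  have "conn_comp u = conn_comp r" if "u \<in> V" for u using assms that conn_comp_eq by auto
  then have "comps \<subseteq> {conn_comp r}" by (auto simp: comps_def)
  then have "card comps \<le> 1" using card_mono[of "{conn_comp r}" comps] by simp
  then have "(2::nat) ^ card comps \<le> 2 ^ 1" by (intro power_increasing) auto
  have "sigma_sep P (int n) \<le> (card V + 1) ^ n * 2 ^ (25 * n) * 2 ^ card comps"
    using sigma_sep_le[of comps n] by simp
  also have "\<dots> \<le> (card V + 1) ^ n * 2 ^ (25 * n) * 2"
    using \<open>2 ^ card comps \<le> 2 ^ 1\<close> by (intro mult_left_mono) auto
  finally show ?thesis .
qed

end

section \<open>Unit disk graphs\<close>

text \<open>The midpoint of a unit cell lies in the disk of every vertex of that cell. Hence these
  vertices are pairwise adjacent, and the ply bounds their number.\<close>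

lemma ex_grid_graph:
  assumes P: "pair_graph P" and emb: "unit_disk_embedding P c" and ply: "embedding_ply P c p"
  shows "\<exists>cell idx. grid_graph P cell idx p"
proof -
  interpret pair_graph P by (rule P)
  let ?V = "pverts P" and ?E = "parcs P"
  define cell :: "'a \<Rightarrow> int \<times> int" where "cell v = (\<lfloor>c v $ 1\<rfloor>, \<lfloor>c v $ 2\<rfloor>)" for v
  define mid :: "int \<times> int \<Rightarrow> real^2" where
    "mid z = vector [of_int (fst z) + 1/2, of_int (snd z) + 1/2]" for z
  have mid: "mid (cell v) \<in> cball (c v) 1" for v
  proof -
    have "\<bar>c v $ 1 - (of_int \<lfloor>c v $ 1\<rfloor> + 1/2)\<bar> \<le> 1/2" "\<bar>c v $ 2 - (of_int \<lfloor>c v $ 2\<rfloor> + 1/2)\<bar> \<le> 1/2"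
      unfolding abs_le_iff by linarith+
    \<comment> \<open>The sum of the coordinate distances, at most 1/2 + 1/2, dominates the
      Euclidean norm.\<close>
    then have "(\<Sum>i\<in>UNIV. \<bar>(c v - mid (cell v)) $ i\<bar>) \<le> 1"
      by (simp add: UNIV_2 mid_def cell_def)
    then show ?thesis using norm_le_l1_cart[of "c v - mid (cell v)"] by (simp add: dist_norm)
  qed
  define W where "W z = {v \<in> ?V. cell v = z}" for z
  have finV: "finite ?V" by (rule pair_finite_verts)
  have "\<exists>h. bij_betw h (W z) {0..<card (W z)}" for z
    using finV by (intro ex_bij_betw_finite_nat) (simp add: W_def)
  then obtain h where h: "bij_betw (h z) (W z) {0..<card (W z)}" for z by metis
  have W_ply: "card (W z) \<le> p" for z
  proof -
    have "card (W z) \<le> card {v \<in> ?V. mid z \<in> cball (c v) 1}"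
      using finV mid by (intro card_mono) (auto simp: W_def)
    then show ?thesis using ply by (auto simp: embedding_ply_def intro: order_trans)
  qed
  define idx where "idx v = h (cell v) v" for v
  have "grid_graph P cell idx p"
  proof
    show "finite ?V" by (rule finV)
    show "?E \<subseteq> ?V \<times> ?V" using in_arcsD1 in_arcsD2 by auto
    show "sym ?E" using pair_sym_arcs by (simp add: symmetric_def)
  next
    fix u v assume uv: "u \<in> ?V" "v \<in> ?V" "u \<noteq> v" "cell u = cell v"
    then have "mid (cell u) \<in> cball (c u) 1 \<inter> cball (c v) 1" using mid[of u] mid[of v] by simp
    then show "(u, v) \<in> ?E" using emb uv unfolding unit_disk_embedding_def by blast
  next
    fix u v assume uv: "(u, v) \<in> ?E"
    then have "u \<in> ?V" "v \<in> ?V" "u \<noteq> v" using in_arcsD1 in_arcsD2 pair_no_loops by force+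
    then obtain x where "x \<in> cball (c u) 1 \<inter> cball (c v) 1"
      using emb uv unfolding unit_disk_embedding_def by blast
    then have "norm (c v - c u) \<le> 2"
      using dist_triangle[of "c v" "c u" x] by (simp add: dist_norm[symmetric] dist_commute)
    then have "\<bar>c v $ i - c u $ i\<bar> \<le> 2" for i
      using component_le_norm_cart[of "c v - c u" i] by simp
    then have "c v $ i \<le> c u $ i + 2" "c u $ i \<le> c v $ i + 2" for i
      by (smt (verit))+
    then have "\<lfloor>c v $ i\<rfloor> \<le> \<lfloor>c u $ i\<rfloor> + 2" "\<lfloor>c u $ i\<rfloor> \<le> \<lfloor>c v $ i\<rfloor> + 2" for i
      using floor_mono[of _ "_ + of_int 2"] by (metis floor_add_int of_int_numeral floor_mono)+
    then show "cell v - cell u \<in> offsets"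
      by (simp add: cell_def offsets_def algebra_simps)
  next
    fix v assume "v \<in> ?V"
    then have "v \<in> W (cell v)" by (simp add: W_def)
    then show "idx v < p"
      using bij_betw_apply[OF h] W_ply[of "cell v"] by (fastforce simp: idx_def)
  next
    show "inj_on (\<lambda>v. (cell v, idx v)) ?V"
    proof (rule inj_onI)
      fix u v assume uv: "u \<in> ?V" "v \<in> ?V" "(cell u, idx u) = (cell v, idx v)"
      then have "u \<in> W (cell v)" "v \<in> W (cell v)" "h (cell v) u = h (cell v) v"
        by (auto simp: W_def idx_def)
      then show "u = v" using bij_betw_imp_inj_on[OF h] by (blast dest: inj_onD)
    qed
  next
    fix v assume "v \<in> ?V"
    then have "v \<in> W (cell v)" by (simp add: W_def)
    then have "0 < card (W (cell v))" using finV by (auto simp: W_def card_gt_0_iff)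
    then have "0 \<in> h (cell v) ` W (cell v)" using bij_betw_imp_surj_on[OF h] by simp
    then show "\<exists>w\<in>?V. cell w = cell v \<and> idx w = 0" by (force simp: W_def idx_def)
  qed
  then show ?thesis by blast
qed

text \<open>Orders are natural numbers, so only the empty family qualifies; both bounds are then
  trivial.\<close>

lemma sigma_sep_neg:
  assumes "s < 0"
  shows "sigma_sep P s = 0"
proof -
  have "noniso_seps P s = {{}}" using assms by (force simp: noniso_seps_def)
  then show ?thesis by (simp add: sigma_sep_def)
qed

text \<open>Connectedness is strong connectedness of the symmetric closure, which adds no arcs
  here.\<close>

lemma conn_comp_if_connected:
  assumes "grid_graph P cell idx p" and "Digraph_Component.connected (with_proj P)"
  shows "\<exists>r. pverts P \<subseteq> grid_graph.conn_comp P r"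
proof -
  interpret grid_graph P cell idx p by fact
  have "r \<in> V \<Longrightarrow> v \<in> V \<Longrightarrow> v \<in> conn_comp r" for r v
  proof -
    assume "r \<in> V" "v \<in> V"
    then have "(r, v) \<in> rtrancl_on V (parcs (mk_symmetric (with_proj P)))"
      using assms(2) by (auto simp: connected_def strongly_connected_def reachable_def mk_symmetric_def)
    then show "v \<in> conn_comp r"
    proof induction
      case base
      show ?case by (rule self_in_conn_comp)
    next
      case (step y z)
      then have "(y, z) \<in> E" using sym_arcs by (auto simp: mk_symmetric_def dest: symD)
      then show ?case using step by (auto simp: conn_comp_def intro: rtrancl_into_rtrancl)
    qed
  qed
  then show ?thesis by blast
qed

text \<open>With \<open>y = x powr (1/4)\<close>, the bounds \<open>ln y \<le> y - 1\<close> and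
  \<open>ln 2 \<ge> 2/3\<close> give \<open>log 2 x \<le> 6 * y\<close>; then square. This lets
  about \<open>sqrt k\<close> counts of \<open>log k\<close> bits fit into
  \<open>O(k / log k)\<close>.\<close>

lemma log2_squared_le_sqrt:
  assumes "x \<ge> (1::real)"
  shows "(log 2 x)\<^sup>2 \<le> 36 * x powr (1/2)"
proof -
  define y where "y = x powr (1/4)"
  have y: "y > 0" "ln x = 4 * ln y" using assms by (simp_all add: y_def ln_powr)
  have "ln x \<le> 4 * y" using ln_le_minus_one[OF y(1)] y(2) by linarith
  moreover have "log 2 x * (2/3) \<le> log 2 x * ln 2"
    using ln2_ge_two_thirds assms by (intro mult_left_mono) auto
  moreover have "log 2 x * ln 2 = ln x" by (simp add: log_def)
  ultimately have "log 2 x \<le> 6 * y" by linarith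
  then have "(log 2 x)\<^sup>2 \<le> (6 * y)\<^sup>2" using assms by (intro power_mono) auto
  also have "\<dots> = 36 * x powr (1/2)"
    by (simp add: y_def power2_eq_square powr_add[symmetric])
  finally show ?thesis .
qed

text \<open>For \<open>k \<ge> 2\<close> we have \<open>k + 1 \<le> k * k\<close>, whence the factor
  2 in the exponent.\<close>

lemma Suc_power_le_powr:
  assumes "k \<ge> (2::nat)"
  shows "real ((k + 1) ^ n) \<le> 2 powr (2 * (real n * log 2 (real k)))"
proof -
  have "k + 1 \<le> 2 * k" "2 * k \<le> k * k" using assms by simp_all
  then have "(k + 1) ^ n \<le> (k ^ 2) ^ n" unfolding power2_eq_square by (intro power_mono) linarith+
  then have "real ((k + 1) ^ n) \<le> real k ^ (2 * n)"
    unfolding power_mult[symmetric] by (metis of_nat_le_iff of_nat_power)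
  also have "\<dots> = (2 powr log 2 k) powr (2 * n)"
    using assms by (simp add: powr_realpow[symmetric])
  also have "\<dots> = 2 powr (2 * (real n * log 2 (real k)))"
    by (simp add: powr_powr mult_ac)
  finally show ?thesis .
qed

section \<open>Explicit bounds and the choice of the size threshold\<close>

context grid_graph
begin

lemma sigma_sep_le_connected:
  assumes "V \<subseteq> conn_comp r" and k: "card V = k" "k \<ge> 2" and n: "n \<ge> 1"
  shows "real (sigma_sep P (int n)) \<le> 2 powr (28 * (n * log 2 k))"
proof -
  have L: "log 2 k \<ge> 1" using k(2) by (simp add: le_log_iff)
  have "real (sigma_sep P (int n)) \<le> real ((k + 1) ^ n * 2 ^ (25 * n) * 2)"
    using sigma_sep_le_if_one_comp[OF assms(1)] k(1) of_nat_mono by blast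
  also have "\<dots> = real ((k + 1) ^ n) * 2 powr (25 * n + 1)"
    by (simp add: powr_add powr_realpow[symmetric])
  also have "\<dots> \<le> 2 powr (2 * (n * log 2 k)) * 2 powr (25 * n + 1)"
    using Suc_power_le_powr[OF k(2)] by (intro mult_right_mono) auto
  also have "\<dots> = 2 powr (2 * (n * log 2 k) + (25 * n + 1))" by (simp add: powr_add)
  \<comment> \<open>Both \<open>n\<close> and 1 are at most \<open>n * log 2 k\<close>, so the
    coefficients add up to 2 + 25 + 1 = 28.\<close>
  also have "\<dots> \<le> 2 powr (28 * (n * log 2 k))"
  proof (rule powr_mono)
    have "real n \<le> n * log 2 k" using mult_left_mono[OF L, of "real n"] by simp
    then show "2 * (n * log 2 k) + (25 * n + 1) \<le> 28 * (n * log 2 k)" using n by linarith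
  qed simp
  finally show ?thesis .
qed

lemma sigma_sep_le_general:
  assumes k: "card V = k" "k \<ge> 2"
  shows "real (sigma_sep P (int n)) \<le> 2 powr (150 * (n * log 2 k + real p * k / log 2 k))"
proof -
  define L where "L = log 2 k"
  have L: "L \<ge> 1" unfolding L_def using k(2) by (simp add: le_log_iff)
  obtain v where "v \<in> V" using k by fastforce
  then have p: "p \<ge> 1" using idx_less by fastforce
  \<comment> \<open>The threshold balances two needs: \<open>25 * p * m \<le> L / 2\<close> leaves
    at most \<open>sqrt k\<close> small types, while \<open>m + 1 \<ge> L / (50 * p)\<close> allows
    at most \<open>50 * p * k / L\<close> big components. If \<open>m = 0\<close>, every component
    is big.\<close>
  define m where "m = nat \<lfloor>L / (50 * p)\<rfloor>"
  have m: "real m \<le> L / (50 * p)" "L / (50 * p) \<le> real (Suc m)"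
    unfolding m_def using L by (simp, linarith)
  define q where "q = real p * k / L"
  define Big where "Big = {K \<in> comps. m < card K}"
  define t where "t = card (comp_graph ` (comps - Big))"
  have big: "real (card Big) \<le> 50 * q"
  proof -
    have "card Big * (L / (50 * p)) \<le> card Big * real (Suc m)" using m by (intro mult_left_mono) auto
    also have "\<dots> = real (card Big * Suc m)" by (rule of_nat_mult[symmetric])
    also have "\<dots> \<le> k" using card_big_comps[of m] k(1) unfolding Big_def of_nat_le_iff by simp
    finally show ?thesis using L p by (simp add: q_def field_simps)
  qed
  have small: "2 * (t * L) \<le> 72 * q"
  proof -
    have "comps - Big = {K \<in> comps. card K \<le> m}" by (auto simp: Big_def)
    then have "real t \<le> real (2 ^ (25 * p * m))"
      unfolding t_def using card_comp_graphs_small[of m] by (simp only: of_nat_le_iff)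
    also have "\<dots> = 2 powr (25 * p * m)" by (simp add: powr_realpow[symmetric])
    also have "\<dots> \<le> 2 powr (L * (1/2))"
      using m(1) p by (intro powr_mono) (simp_all add: field_simps)
    also have "\<dots> = k powr (1/2)" using k(2) by (simp only: powr_powr[symmetric] L_def) simp
    finally have t: "real t \<le> k powr (1/2)" .
    \<comment> \<open>The squared logarithm leaves a spare factor \<open>L\<close> to divide by,
      giving \<open>t * L \<le> 36 * k / L\<close>.\<close>
    have "t * L\<^sup>2 \<le> k powr (1/2) * (36 * k powr (1/2))"
      using t log2_squared_le_sqrt[of k] k(2) unfolding L_def by (intro mult_mono) auto
    also have "\<dots> = 36 * real k" using k(2) by (simp add: powr_add[symmetric])
    finally have "t * L \<le> 36 * (k / L)" using L by (simp add: field_simps power2_eq_square)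
    also have "\<dots> \<le> 36 * q"
    proof -
      have "real k \<le> real p * real k" using p mult_right_mono[of 1 "real p" "real k"] by simp
      then show ?thesis unfolding q_def using L by (intro mult_left_mono divide_right_mono) auto
    qed
    finally show ?thesis by linarith
  qed
  have "real (sigma_sep P (int n)) \<le> real ((k + 1) ^ n * 2 ^ (25 * n) * 2 ^ card Big * (k + 1) ^ t)"
    using sigma_sep_le[of Big n] k(1) of_nat_mono unfolding t_def Big_def by blast
  also have "\<dots> = real ((k + 1) ^ n) * 2 powr (25 * n + card Big) * real ((k + 1) ^ t)"
    by (simp add: powr_add powr_realpow[symmetric])
  also have "\<dots> \<le> 2 powr (2 * (n * L)) * 2 powr (25 * n + card Big) * 2 powr (2 * (t * L))"
    unfolding L_def using Suc_power_le_powr[OF k(2)] by (intro mult_mono) auto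
  also have "\<dots> = 2 powr (2 * (n * L) + 25 * n + card Big + 2 * (t * L))"
    by (simp add: powr_add)
  \<comment> \<open>The coefficient of \<open>n * L\<close> is at most 2 + 25 = 27 and that of
    \<open>q\<close> at most 50 + 72 = 122; 150 exceeds both.\<close>
  also have "\<dots> \<le> 2 powr (150 * (n * L + q))"
  proof (rule powr_mono)
    have "real n \<le> n * L" using mult_left_mono[OF L, of "real n"] by simp
    moreover have "0 \<le> q" using L by (simp add: q_def)
    ultimately show "2 * (n * L) + 25 * n + card Big + 2 * (t * L) \<le> 150 * (n * L + q)"
      using big small unfolding distrib_left by linarith
  qed simp
  finally show ?thesis unfolding q_def L_def .
qed

end

text \<open>\<open>k \<ge> 2\<close> keeps \<open>log 2 k\<close> positive. For \<open>s = 0\<close>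
  a connected graph has the two non-isomorphic separations \<open>(V, {})\<close> and
  \<open>({}, V)\<close>, while the second bound would be 1; hence \<open>s \<noteq> 0\<close>
  there.\<close>

theorem theorem2:
  shows "(\<exists>C>0. \<forall>(P :: 'a pair_pre_digraph) (c :: 'a \<Rightarrow> real^2) (k::nat) (p::nat) (s::int).
            pair_graph P \<and> unit_disk_embedding P c \<and> embedding_ply P c p \<and>
            card (pverts P) = k \<and> k \<ge> 2 \<longrightarrow>
            real (sigma_sep P s) \<le>
              2 powr (C * (of_int s * log 2 (real k) + real p * real k / log 2 (real k)))) \<and>
         (\<exists>C>0. \<forall>(P :: 'a pair_pre_digraph) (c :: 'a \<Rightarrow> real^2) (k::nat) (p::nat) (s::int).
            pair_graph P \<and> unit_disk_embedding P c \<and> embedding_ply P c p \<and>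
            card (pverts P) = k \<and> k \<ge> 2 \<and> Digraph_Component.connected (with_proj P) \<and> s \<noteq> 0 \<longrightarrow>
            real (sigma_sep P s) \<le> 2 powr (C * (of_int s * log 2 (real k))))"
proof (rule conjI)
  show "\<exists>C>0. \<forall>(P :: 'a pair_pre_digraph) (c :: 'a \<Rightarrow> real^2) (k::nat) (p::nat) (s::int).
      pair_graph P \<and> unit_disk_embedding P c \<and> embedding_ply P c p \<and>
      card (pverts P) = k \<and> k \<ge> 2 \<longrightarrow>
      real (sigma_sep P s) \<le>
        2 powr (C * (of_int s * log 2 (real k) + real p * real k / log 2 (real k)))"
  proof (rule exI[of _ 150], intro conjI allI impI)
    fix P :: "'a pair_pre_digraph" and c :: "'a \<Rightarrow> real^2" and k p :: nat and s :: int
    assume *: "pair_graph P \<and> unit_disk_embedding P c \<and> embedding_ply P c p \<and>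
      card (pverts P) = k \<and> k \<ge> 2"
    then obtain cell idx where g: "grid_graph P cell idx p" using ex_grid_graph by blast
    show "real (sigma_sep P s) \<le>
        2 powr (150 * (of_int s * log 2 (real k) + real p * real k / log 2 (real k)))"
    proof (cases "s < 0")
      case False
      then have "s = int (nat s)" by simp
      then show ?thesis
        using grid_graph.sigma_sep_le_general[OF g, of k "nat s"] * by (metis of_int_of_nat_eq)
    qed (simp add: sigma_sep_neg)
  qed simp
  show "\<exists>C>0. \<forall>(P :: 'a pair_pre_digraph) (c :: 'a \<Rightarrow> real^2) (k::nat) (p::nat) (s::int).
      pair_graph P \<and> unit_disk_embedding P c \<and> embedding_ply P c p \<and>
      card (pverts P) = k \<and> k \<ge> 2 \<and> Digraph_Component.connected (with_proj P) \<and> s \<noteq> 0 \<longrightarrow>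
      real (sigma_sep P s) \<le> 2 powr (C * (of_int s * log 2 (real k)))"
  proof (rule exI[of _ 28], intro conjI allI impI)
    fix P :: "'a pair_pre_digraph" and c :: "'a \<Rightarrow> real^2" and k p :: nat and s :: int
    assume *: "pair_graph P \<and> unit_disk_embedding P c \<and> embedding_ply P c p \<and>
      card (pverts P) = k \<and> k \<ge> 2 \<and> Digraph_Component.connected (with_proj P) \<and> s \<noteq> 0"
    then obtain cell idx where g: "grid_graph P cell idx p" using ex_grid_graph by blast
    obtain r where r: "pverts P \<subseteq> grid_graph.conn_comp P r"
      using conn_comp_if_connected[OF g] * by blast
    show "real (sigma_sep P s) \<le> 2 powr (28 * (of_int s * log 2 (real k)))"
    proof (cases "s < 0")
      case False
      then have s: "s = int (nat s)" "nat s \<ge> 1" using * by linarith+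
      then show ?thesis
        using grid_graph.sigma_sep_le_connected[OF g r, of k "nat s"] * by (metis of_int_of_nat_eq)
    qed (simp add: sigma_sep_neg)
  qed simp
qed

end
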